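(* Consider the variety of abelian groups and presentations with a single generator $a$ and a single relator $w(a)=\sum_{i=1}^{m} d_i a$, $d_i=\pm1$, and let $X=\sum_{i=1}^m d_i$. For every odd prime $p$ and every integer $n\ge 0$, the property $p^{n+1}\mid X$ has limiting density $\frac{1}{p^{n+1}}$.
   Context: A relator of length $m$ is a formal sum $d_1a+\cdots+d_ma$ with each $d_i\in\{1,-1\}$ (so there are $2^m$ relators of length $m$; the relator of length $0$ is the empty sum). $X$ is the difference between the number of occurrences of $a$ and the number of occurrences of its inverse in the relator. Let $P_s$ be the number of relators of length at most $s$, and for a property $Q$ of relators let $P_s(Q)$ be the number of relators of length at most $s$ with property $Q$. The limiting density of $Q$ is $\lim_{s\to\infty}P_s(Q)/P_s$, if this limit exists. *)

theory Defs
  imports Complex_Main "HOL-Computational_Algebra.Primes"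
begin

(* The relator d_1 a + ... + d_m a is the list [d_1, ..., d_m]. Relators are formal sums: they are
   counted as sequences of signs, not as elements of the free abelian group on a, so that there are
   2^m of length m. *)
definition relators :: "int list set" where
  "relators = lists {1, -1}"

definition exponent_sum :: "int list \<Rightarrow> int" where
  "exponent_sum w = sum_list w"

(* P_s(Q); P_s itself is the case where Q holds of every relator. *)
definition relator_count :: "(int list \<Rightarrow> bool) \<Rightarrow> nat \<Rightarrow> nat" where
  "relator_count Q s = card {w \<in> relators. length w \<le> s \<and> Q w}"

(* The limit exists and equals d. *)
definition has_limiting_density :: "(int list \<Rightarrow> bool) \<Rightarrow> real \<Rightarrow> bool" where
  "has_limiting_density Q d \<longleftrightarrow>
     (\<lambda>s. real (relator_count Q s) / real (relator_count (\<lambda>_. True) s)) \<longlonglongrightarrow> d"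

lemma card_relators_length: "card {w \<in> relators. length w = m} = 2 ^ m"
proof -
  have "{w \<in> relators. length w = m} = {w. set w \<subseteq> {1, -1} \<and> length w = m}"
    by (auto simp: relators_def)
  then show ?thesis
    using card_lists_length_eq[of "{1, -1 :: int}" m] by (simp add: numeral_2_eq_2)
qed

lemma finite_relators_length_le: "finite {w \<in> relators. length w \<le> s \<and> Q w}"
proof (rule finite_subset)
  show "{w \<in> relators. length w \<le> s \<and> Q w} \<subseteq> {w. set w \<subseteq> {1, -1 :: int} \<and> length w \<le> s}"
    by (auto simp: relators_def)
qed (simp add: finite_lists_length_le)

end

theory Submission
  imports Defs
begin

text \<open>
  Put N = p^(n+1). By orthogonality of the characters of the integers modulo N, the indicator of
  N dividing X is the average of cos (2 pi j X / N) over j < N. Summing cos (t X) over all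
  relators of length m gives (2 cos t)^m, so j = 0 contributes exactly 2^m / N to the count for
  length m. For 0 < j < N the fact that N is odd gives |2 cos (2 pi j / N)| < 2, so these terms
  are negligible against the total number of relators.
\<close>

lemma finite_relators_length: "finite {w \<in> relators. length w = m}"
  \<comment> \<open>An infinite set would have \<open>card\<close> equal to 0, so the positive value
    \<open>2 ^ m\<close> already forces finiteness.\<close>
  by (rule card_ge_0_finite) (simp add: card_relators_length)

text \<open>Prepending \<open>1\<close> or \<open>-1\<close> moves the angle u = t X by t or -t, and
  cos (u + t) + cos (u - t) = 2 cos t cos u; so each further letter contributes one factor
  \<open>2 * cos t\<close>.\<close>

lemma sum_cos_exponent_sum:
  fixes t :: real
  shows "(\<Sum>w | w \<in> relators \<and> length w = m. cos (t * of_int (exponent_sum w))) = (2 * cos t) ^ m"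
proof (induction m)
  case 0
  have "{w \<in> relators. length w = 0} = {[]}"
    by (auto simp: relators_def)
  then show ?case by (simp add: exponent_sum_def)
next
  case (Suc m)
  let ?R = "{w \<in> relators. length w = m}"
  have split: "{w \<in> relators. length w = Suc m} = (#) 1 ` ?R \<union> (#) (-1) ` ?R"
    by (auto simp: relators_def length_Suc_conv image_iff)
  have "(\<Sum>w | w \<in> relators \<and> length w = Suc m. cos (t * of_int (exponent_sum w))) =
        (\<Sum>w\<in>?R. cos (t * of_int (exponent_sum (1 # w)))) +
        (\<Sum>w\<in>?R. cos (t * of_int (exponent_sum ((-1) # w))))"
    unfolding split
    by (subst sum.union_disjoint) (auto simp: finite_relators_length sum.reindex)
  also have "\<dots> = (\<Sum>w\<in>?R. 2 * cos t * cos (t * of_int (exponent_sum w)))"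
    unfolding sum.distrib[symmetric]
    by (intro sum.cong refl) (simp add: exponent_sum_def distrib_left right_diff_distrib cos_add cos_diff)
  also have "\<dots> = (2 * cos t) ^ Suc m"
    using Suc.IH by (simp add: sum_distrib_left[symmetric])
  finally show ?case .
qed

text \<open>The sum is the real part of a geometric series in an N-th root of unity
  \<open>z\<close>, which equals 1 exactly when N divides \<open>x\<close>.\<close>

lemma sum_cos_roots_of_unity:
  fixes N :: nat and x :: int
  assumes "N > 0"
  shows "(\<Sum>j<N. cos (2 * pi * real j / real N * of_int x)) = (if int N dvd x then real N else 0)"
proof -
  define z where "z = cis (2 * pi * of_int x / real N)"
  have Re_z: "Re (z ^ j) = cos (2 * pi * real j / real N * of_int x)" for j
    by (simp add: z_def DeMoivre mult_ac)
  have z_eq_1: "z = 1 \<longleftrightarrow> int N dvd x"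
  proof
    assume "z = 1"
    then have "cos (2 * pi * of_int x / real N) = 1"
      by (simp add: z_def complex_eq_iff)
    then obtain k :: int where "2 * pi * of_int x / real N = of_int k * 2 * pi"
      by (auto simp: cos_one_2pi_int)
    then have "real_of_int x = of_int (k * int N)"
      using assms by (simp add: field_simps)
    then show "int N dvd x"
      by (simp only: of_int_eq_iff dvd_triv_right)
  next
    assume "int N dvd x"
    then obtain k where "x = int N * k" ..
    then show "z = 1"
      using assms cis_multiple_2pi[of "of_int k"] by (simp add: z_def mult.assoc)
  qed
  have z_pow: "z ^ N = 1"
    using assms cis_multiple_2pi[of "of_int x"] by (simp add: z_def DeMoivre)
  have "(\<Sum>j<N. cos (2 * pi * real j / real N * of_int x)) = Re (\<Sum>j<N. z ^ j)"
    by (simp add: Re_z)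
  also have "\<dots> = (if int N dvd x then real N else 0)"
    \<comment> \<open>For \<open>z\<close> different from 1 the closed form has numerator
      \<open>z ^ N - 1\<close>, which is 0. Deleting \<open>Re_sum\<close> keeps the complex sum
      intact so that the closed form applies.\<close>
    using z_pow by (auto simp: z_eq_1[symmetric] geometric_sum simp del: Re_sum)
  finally show ?thesis .
qed

lemma card_dvd_exponent_sum:
  fixes N :: nat
  assumes "N > 0"
  shows "real (card {w \<in> relators. length w = m \<and> int N dvd exponent_sum w}) =
         (\<Sum>j<N. (2 * cos (2 * pi * real j / real N)) ^ m) / real N"
proof -
  let ?R = "{w \<in> relators. length w = m}"
  have "(\<Sum>j<N. (2 * cos (2 * pi * real j / real N)) ^ m) =
        (\<Sum>j<N. \<Sum>w\<in>?R. cos (2 * pi * real j / real N * of_int (exponent_sum w)))"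
    by (simp only: sum_cos_exponent_sum)
  also have "\<dots> = (\<Sum>w\<in>?R. if int N dvd exponent_sum w then real N else 0)"
    by (subst sum.swap) (simp only: sum_cos_roots_of_unity[OF assms])
  also have "\<dots> = (\<Sum>w\<in>{w \<in> ?R. int N dvd exponent_sum w}. real N)"
    by (rule sum.inter_filter[OF finite_relators_length, symmetric])
  finally show ?thesis
    using assms by (simp add: conj_assoc)
qed

lemma relator_count_eq_sum:
  "relator_count Q s = (\<Sum>m\<le>s. card {w \<in> relators. length w = m \<and> Q w})"
proof -
  have "{w \<in> relators. length w \<le> s \<and> Q w} =
        (\<Union>m\<in>{..s}. {w \<in> relators. length w = m \<and> Q w})"
    by auto
  moreover have "finite {w \<in> relators. length w = m \<and> Q w}" for m
    by (rule finite_subset[OF _ finite_relators_length[of m]]) auto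
  ultimately show ?thesis
    unfolding relator_count_def by (simp only:) (subst card_UN_disjoint, auto)
qed

lemma relator_count_True: "relator_count (\<lambda>_. True) s = (\<Sum>m\<le>s. 2 ^ m)"
  by (simp add: relator_count_eq_sum card_relators_length)

text \<open>The numerator grows at most like \<open>y ^ s\<close> for some \<open>y < b\<close>,
  while the denominator is at least its last term \<open>b ^ s\<close>.\<close>

lemma sum_powers_ratio_tendsto_0:
  fixes x b :: real
  assumes "\<bar>x\<bar> < b" "1 < b"
  shows "(\<lambda>s. (\<Sum>m\<le>s. x ^ m) / (\<Sum>m\<le>s. b ^ m)) \<longlonglongrightarrow> 0"
proof -
  \<comment> \<open>Working with \<open>y > 1\<close> instead of \<open>\<bar>x\<bar>\<close> treats
    \<open>\<bar>x\<bar> \<le> 1\<close> uniformly: the sum of the powers of \<open>y\<close> is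
    then below \<open>y ^ Suc s / (y - 1)\<close>.\<close>
  obtain y where y: "max 1 \<bar>x\<bar> < y" "y < b"
    using dense[of "max 1 \<bar>x\<bar>" b] assms by auto
  have "(\<lambda>s. (y / b) ^ s) \<longlonglongrightarrow> 0"
    using y by (intro LIMSEQ_realpow_zero) auto
  then have lim: "(\<lambda>s. y / (y - 1) * (y / b) ^ s) \<longlonglongrightarrow> 0"
    by (rule tendsto_mult_right_zero)
  have bound: "norm ((\<Sum>m\<le>s. x ^ m) / (\<Sum>m\<le>s. b ^ m)) \<le> y / (y - 1) * (y / b) ^ s" for s
  proof -
    have "\<bar>\<Sum>m\<le>s. x ^ m\<bar> \<le> (\<Sum>m\<le>s. y ^ m)"
      by (rule order_trans[OF sum_abs sum_mono]) (use y in \<open>auto simp: power_abs intro: power_mono\<close>)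
    also have "\<dots> = (y ^ Suc s - 1) / (y - 1)"
      using y geometric_sum[of y "Suc s"] by (simp add: lessThan_Suc_atMost)
    also have "\<dots> \<le> y ^ Suc s / (y - 1)"
      using y by (intro divide_right_mono) auto
    finally have num: "\<bar>\<Sum>m\<le>s. x ^ m\<bar> \<le> y ^ Suc s / (y - 1)" .
    have den: "b ^ s \<le> (\<Sum>m\<le>s. b ^ m)"
      by (rule member_le_sum) (use assms in auto)
    have b_pos: "0 < b ^ s"
      using assms by simp
    have "norm ((\<Sum>m\<le>s. x ^ m) / (\<Sum>m\<le>s. b ^ m)) = \<bar>\<Sum>m\<le>s. x ^ m\<bar> / (\<Sum>m\<le>s. b ^ m)"
      using den b_pos by simp
    also have "\<dots> \<le> (y ^ Suc s / (y - 1)) / b ^ s"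
      by (rule frac_le) (use num den b_pos y in auto)
    also have "\<dots> = y / (y - 1) * (y / b) ^ s"
      by (simp add: power_divide)
    finally show ?thesis .
  qed
  show ?thesis
    by (rule tendsto_norm_zero_cancel, rule tendsto_sandwich[OF _ _ tendsto_const lim])
       (use bound in auto)
qed

text \<open>Absolute value 1 would make the sine vanish, so that 2 j = k N for an integer k; as N is
  odd it would divide j, which lies strictly between 0 and N. For even N the index j = N/2 gives
  cosine -1.\<close>

lemma abs_cos_less_1:
  fixes N j :: nat
  assumes "odd N" "0 < j" "j < N"
  shows "\<bar>cos (2 * pi * real j / real N)\<bar> < 1"
proof -
  let ?t = "2 * pi * real j / real N"
  have "sin ?t \<noteq> 0"
  proof
    assume "sin ?t = 0"
    then obtain k :: int where "?t = of_int k * pi"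
      by (auto simp: sin_zero_iff_int2)
    then have "real_of_int (2 * int j) = of_int (k * int N)"
      using assms by (simp add: field_simps)
    then have "int N dvd 2 * int j"
      by (simp only: of_int_eq_iff dvd_triv_right)
    moreover have "coprime (int N) 2"
      using assms by simp
    ultimately have "int N dvd int j"
      by (simp add: coprime_dvd_mult_right_iff)
    then show False
      using assms by (auto dest: dvd_imp_le)
  qed
  then have "(cos ?t)\<^sup>2 < 1"
    using sin_cos_squared_add[of ?t] zero_less_power2[of "sin ?t"] by linarith
  then show ?thesis
    by (simp add: abs_square_less_1)
qed

lemma limiting_density_dvd_exponent_sum:
  fixes N :: nat
  assumes "odd N"
  shows "has_limiting_density (\<lambda>w. int N dvd exponent_sum w) (1 / real N)"
proof -
  have N: "N > 0"
    using assms by (rule odd_pos)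
  let ?c = "\<lambda>j. 2 * cos (2 * pi * real j / real N)"
  \<comment> \<open>\<open>?r j s\<close> is the share of the j-th character; the density ratio is
    the average of these N shares, and only j = 0 survives in the limit.\<close>
  let ?r = "\<lambda>j s. (\<Sum>m\<le>s. ?c j ^ m) / (\<Sum>m\<le>s. 2 ^ m)"
  have ratio: "real (relator_count (\<lambda>w. int N dvd exponent_sum w) s) /
               real (relator_count (\<lambda>_. True) s) = (\<Sum>j<N. ?r j s) / real N" for s
  proof -
    have "real (relator_count (\<lambda>w. int N dvd exponent_sum w) s) =
          (\<Sum>j<N. \<Sum>m\<le>s. ?c j ^ m) / real N"
      unfolding relator_count_eq_sum of_nat_sum card_dvd_exponent_sum[OF N]
      by (subst sum.swap) (simp only: sum_divide_distrib)
    then show ?thesis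
      by (simp add: relator_count_True sum_divide_distrib mult.commute)
  qed
  have lim: "?r j \<longlonglongrightarrow> (if j = 0 then 1 else 0)" if "j \<in> {..<N}" for j
  proof (cases "j = 0")
    case True
    \<comment> \<open>Here \<open>?r 0 s\<close> is a quotient of equal sums; a nonzero denominator
      makes it 1 rather than the default 0.\<close>
    have "(\<Sum>m\<le>s. 2 ^ m) \<noteq> (0 :: real)" for s :: nat
      by (rule less_imp_neq[symmetric], rule sum_pos) auto
    with True show ?thesis by simp
  next
    case False
    with that have "\<bar>?c j\<bar> < 2"
      using abs_cos_less_1[OF assms, of j] by (simp add: abs_mult)
    with False show ?thesis
      using sum_powers_ratio_tendsto_0[of "?c j" 2] by simp
  qed
  have "(\<lambda>s. (\<Sum>j<N. ?r j s) / real N) \<longlonglongrightarrow> (\<Sum>j<N. if j = 0 then 1 else 0) / real N"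
    by (intro tendsto_divide tendsto_sum tendsto_const lim) (use N in auto)
  then show ?thesis
    using N by (simp add: has_limiting_density_def ratio)
qed

theorem lemma3p32:
  fixes p n :: nat
  assumes "prime p" and "odd p"
  shows "has_limiting_density (\<lambda>w. int p ^ (n + 1) dvd exponent_sum w) (1 / real p ^ (n + 1))"
  using limiting_density_dvd_exponent_sum[of "p ^ (n + 1)"] assms(2) by simp

end
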